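(* Let $k, p$ be positive integers. Then $$\mathcal{C}_{\mathrm{imp}}(k,2p) \leq 2\,\mathcal{C}_{\mathrm{exp}}(k,p).$$
   Context: A linear multistep method (LM method) with $k$ steps computes $u_n = \sum_{j=1}^{k} \alpha_j u_{n-j} + h \sum_{j=0}^k \beta_j f(u_{n-j})$ and is identified with its real coefficients $(\alpha_j)_{j=1}^k$, $(\beta_j)_{j=0}^k$ (no requirement that $\alpha_k$ or $\beta_k$ be non-zero). It is explicit if $\beta_0=0$; in the class of implicit methods, $\beta_0$ is unrestricted (the value $\beta_0=0$ is allowed). With the convention $0^0=1$, a method has order $p$ if $\sum_{j=1}^{k}\alpha_j=1$ and $\sum_{j=1}^{k}(j^m\alpha_j - m j^{m-1}\beta_j) - m\,0^{m-1}\beta_0=0$ for all $1\le m\le p$. The SSP coefficient of a method is $\mathcal{C}=\min\{\alpha_j/\beta_j : 1\le j\le k,\ \beta_j\ne 0\}$ (with $\min\emptyset=+\infty$) if $\alpha_j\ge 0$ for $1\le j\le k$ and $\beta_j\ge 0$ for $0\le j\le k$, and $\mathcal{C}=0$ otherwise. $\mathcal{C}_{\mathrm{exp}}(k,p)$ (respectively $\mathcal{C}_{\mathrm{imp}}(k,p)$) is the supremum of $\mathcal{C}$ over all explicit (respectively implicit) $k$-step LM methods of order $p$, taken to be $0$ if there are no such methods. *)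

theory Defs
  imports Complex_Main "HOL-Library.Extended_Real"
begin

text \<open>
  A \<open>k\<close>-step linear multistep method is given by its coefficients \<open>\<alpha> j\<close> for \<open>1 \<le> j \<le> k\<close> and
  \<open>\<beta> j\<close> for \<open>0 \<le> j \<le> k\<close>.  The functions are total on \<open>nat\<close>, but none of the notions below
  depends on their values outside these ranges.
\<close>

text \<open>The term for \<open>j = 0\<close> relies on \<open>0 ^ 0 = 1\<close>: it is \<open>\<beta> 0\<close> if \<open>m = 1\<close> and \<open>0\<close> if \<open>m > 1\<close>.\<close>

definition lm_order :: "nat \<Rightarrow> nat \<Rightarrow> (nat \<Rightarrow> real) \<Rightarrow> (nat \<Rightarrow> real) \<Rightarrow> bool" where
  "lm_order k p \<alpha> \<beta> \<longleftrightarrow>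
     (\<Sum>j=1..k. \<alpha> j) = 1 \<and>
     (\<forall>m. 1 \<le> m \<and> m \<le> p \<longrightarrow>
        (\<Sum>j=1..k. real j ^ m * \<alpha> j - real m * real j ^ (m - 1) * \<beta> j)
          - real m * 0 ^ (m - 1) * \<beta> 0 = 0)"

definition lm_explicit :: "(nat \<Rightarrow> real) \<Rightarrow> bool" where
  "lm_explicit \<beta> \<longleftrightarrow> \<beta> 0 = 0"

text \<open>The coefficient \<open>\<beta> 0\<close> enters the sign condition but not the minimum.\<close>

definition ssp_coeff :: "nat \<Rightarrow> (nat \<Rightarrow> real) \<Rightarrow> (nat \<Rightarrow> real) \<Rightarrow> ereal" where
  "ssp_coeff k \<alpha> \<beta> =
     (if (\<forall>j\<in>{1..k}. 0 \<le> \<alpha> j) \<and> (\<forall>j\<in>{0..k}. 0 \<le> \<beta> j)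
      then if {j \<in> {1..k}. \<beta> j \<noteq> 0} = {} then \<infinity>
           else Min ((\<lambda>j. ereal (\<alpha> j / \<beta> j)) ` {j \<in> {1..k}. \<beta> j \<noteq> 0})
      else 0)"

text \<open>The empty case is treated separately because \<open>Sup {} = - \<infinity>\<close> in \<^typ>\<open>ereal\<close>.\<close>

definition C_exp :: "nat \<Rightarrow> nat \<Rightarrow> ereal" where
  "C_exp k p =
     (if \<exists>\<alpha> \<beta>. lm_explicit \<beta> \<and> lm_order k p \<alpha> \<beta>
      then Sup {ssp_coeff k \<alpha> \<beta> | \<alpha> \<beta>. lm_explicit \<beta> \<and> lm_order k p \<alpha> \<beta>}
      else 0)"

text \<open>The class of implicit methods includes the explicit ones.\<close>

definition C_imp :: "nat \<Rightarrow> nat \<Rightarrow> ereal" where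
  "C_imp k p =
     (if \<exists>\<alpha> \<beta>. lm_order k p \<alpha> \<beta>
      then Sup {ssp_coeff k \<alpha> \<beta> | \<alpha> \<beta>. lm_order k p \<alpha> \<beta>}
      else 0)"

end

theory Submission
  imports Defs "HOL-Computational_Algebra.Polynomial"
begin

text \<open>
  A method with nonnegative coefficients and \<open>\<alpha> j \<ge> r * \<beta> j\<close> has order \<open>p\<close> iff the nonnegative
  weights \<open>\<alpha> j - r * \<beta> j\<close> and \<open>\<beta> j\<close> represent the functional \<open>q \<mapsto> q(0)\<close> on polynomials of degree
  at most \<open>p\<close> through \<open>q(j)\<close>, \<open>r q(j) - q'(j)\<close> and \<open>- q'(0)\<close>.  If no explicit method of order \<open>p\<close>
  has coefficient \<open>s > 0\<close>, then Farkas' lemma gives a polynomial \<open>q\<close> of degree at most \<open>p\<close> with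
  \<open>q(j) \<ge> 0\<close> and \<open>s q(j) - q'(j) \<ge> 0\<close> for \<open>1 \<le> j \<le> k\<close> but \<open>q(0) < 0\<close>.  Subtracting the constant
  \<open>q(0)\<close> makes these inequalities strict and the value at \<open>0\<close> zero.  The square
  \<open>Q\<close> of the resulting polynomial has degree at most \<open>2p\<close>, \<open>Q(0) = Q'(0) = 0\<close>, and \<open>Q\<close> and
  \<open>2s Q - Q' = 2q(s q - q')\<close> are positive at \<open>1, \<dots>, k\<close>; so an implicit method of order \<open>2p\<close>
  with coefficient \<open>2s\<close> would have all \<open>\<alpha> j = 0\<close>.
\<close>

section \<open>Farkas' lemma\<close>

lemma farkas:
  fixes v :: "'i \<Rightarrow> 'm \<Rightarrow> real" and b :: "'m \<Rightarrow> real"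
  assumes "finite I" and "finite A"
    and "\<And>x. (\<And>i. i \<in> I \<Longrightarrow> 0 \<le> (\<Sum>m\<in>A. v i m * x m)) \<Longrightarrow> 0 \<le> (\<Sum>m\<in>A. b m * x m)"
  shows "\<exists>c. (\<forall>i\<in>I. 0 \<le> c i) \<and> (\<forall>m\<in>A. b m = (\<Sum>i\<in>I. c i * v i m))"
  using assms(1,3)
proof (induction I arbitrary: v b rule: finite_induct)
  case empty
  \<comment> \<open>With no constraints, the test vector \<open>- b\<close> forces \<open>b\<close>
    to vanish on \<open>A\<close>.\<close>
  have "0 \<le> (\<Sum>m\<in>A. b m * - b m)"
    by (rule empty) simp
  then have "(\<Sum>m\<in>A. b m * b m) \<le> 0"
    by (simp add: sum_negf)
  moreover have "0 \<le> (\<Sum>m\<in>A. b m * b m)"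
    by (intro sum_nonneg) simp
  ultimately have "(\<Sum>m\<in>A. b m * b m) = 0"
    by simp
  then show ?case
    using \<open>finite A\<close> by (simp add: sum_nonneg_eq_0_iff)
next
  case (insert n I)
  define ip where "ip u x = (\<Sum>m\<in>A. u m * x m)" for u x :: "'m \<Rightarrow> real"
  have prems: "0 \<le> ip b x" if "\<And>i. i \<in> insert n I \<Longrightarrow> 0 \<le> ip (v i) x" for x
    using insert.prems[of x] that unfolding ip_def by blast
  have ip_left: "ip (\<lambda>m. u m + t * w m) x = ip u x + t * ip w x" for u w x t
    by (simp add: ip_def algebra_simps sum.distrib sum_distrib_left)
  have ip_right: "ip u (\<lambda>m. x m + t * w m) = ip u x + t * ip u w" for u w x t
    by (simp add: ip_def algebra_simps sum.distrib sum_distrib_left)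
  show ?case
  proof (cases "\<forall>x. (\<forall>i\<in>I. 0 \<le> ip (v i) x) \<longrightarrow> 0 \<le> ip b x")
    case True
    then obtain c where c: "\<forall>i\<in>I. 0 \<le> c i" "\<forall>m\<in>A. b m = (\<Sum>i\<in>I. c i * v i m)"
      using insert.IH[of v b] unfolding ip_def by blast
    have "(\<Sum>i\<in>insert n I. (c(n := 0)) i * v i m) = (\<Sum>i\<in>I. c i * v i m)" for m
      using insert.hyps by (auto intro!: sum.cong)
    with c insert.hyps show ?thesis
      by (intro exI[of _ "c(n := 0)"]) auto
  next
    case False
    then obtain z where z: "\<forall>i\<in>I. 0 \<le> ip (v i) z" "ip b z < 0"
      by (auto simp: not_le)
    \<comment> \<open>\<open>z\<close> meets all constraints from \<open>I\<close> but not the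
      conclusion of \<open>prems\<close>, so it must violate the one for \<open>n\<close>.\<close>
    have neg: "ip (v n) z < 0"
      using prems[of z] z by (metis insert_iff not_le)
    define y where "y m = z m / - ip (v n) z" for m
    have ip_y: "ip u y = ip u z / - ip (v n) z" for u
      unfolding y_def by (simp add: ip_def sum_divide_distrib sum_negf)
    have y: "\<forall>i\<in>I. 0 \<le> ip (v i) y" "ip b y < 0"
      using z neg unfolding ip_y
      by (auto intro!: divide_nonneg_pos divide_neg_pos simp del: divide_minus_right)
    have y_n: "ip (v n) y = -1"
      using neg unfolding ip_y by (simp add: field_simps)
    \<comment> \<open>Composition with the projection along \<open>y\<close> onto the kernel of the functional \<open>v n\<close>.\<close>
    define proj where "proj u = (\<lambda>m. u m + ip u y * v n m)" for u
    have ip_proj: "ip (proj u) x = ip u (\<lambda>m. x m + ip (v n) x * y m)" for u x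
      by (simp add: proj_def ip_left ip_right)
    have "0 \<le> ip (proj b) x" if x: "\<And>i. i \<in> I \<Longrightarrow> 0 \<le> ip (proj (v i)) x" for x
      unfolding ip_proj
    proof (rule prems)
      fix i assume i: "i \<in> insert n I"
      have "ip (proj (v n)) x = 0"
        using y_n unfolding proj_def ip_left by simp
      with x i show "0 \<le> ip (v i) (\<lambda>m. x m + ip (v n) x * y m)"
        unfolding ip_proj[symmetric] by auto
    qed
    then obtain c where c: "\<forall>i\<in>I. 0 \<le> c i" "\<forall>m\<in>A. proj b m = (\<Sum>i\<in>I. c i * proj (v i) m)"
      using insert.IH[of "\<lambda>i. proj (v i)" "proj b"] unfolding ip_def by blast
    \<comment> \<open>Expanding both projections in
      \<open>proj b = (\<Sum>i\<in>I. c i * proj (v i))\<close> leaves exactly this multiple of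
      \<open>v n\<close>. The signs in \<open>y\<close> make it nonnegative.\<close>
    define d where "d = (\<Sum>i\<in>I. c i * ip (v i) y) - ip b y"
    have "0 \<le> (\<Sum>i\<in>I. c i * ip (v i) y)"
      using c(1) y(1) by (intro sum_nonneg) simp
    with y(2) have "0 \<le> d"
      by (simp add: d_def)
    moreover have "b m = (\<Sum>i\<in>insert n I. (c(n := d)) i * v i m)" if "m \<in> A" for m
    proof -
      have "b m + ip b y * v n m
          = (\<Sum>i\<in>I. c i * v i m) + (\<Sum>i\<in>I. c i * ip (v i) y) * v n m"
        using c(2) that
        by (simp add: proj_def distrib_left sum.distrib sum_distrib_right mult.assoc)
      then have "b m = (\<Sum>i\<in>I. c i * v i m) + d * v n m"
        by (simp add: d_def algebra_simps)
      also have "(\<Sum>i\<in>I. c i * v i m) = (\<Sum>i\<in>I. (c(n := d)) i * v i m)"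
        using insert.hyps by (intro sum.cong) auto
      finally show ?thesis
        using insert.hyps by simp
    qed
    ultimately show ?thesis
      using c(1) by (intro exI[of _ "c(n := d)"]) auto
  qed
qed

section \<open>Order conditions as an identity for polynomials\<close>

lemma pderiv_sum: "pderiv (sum f A) = (\<Sum>x\<in>A. pderiv (f x))"
  using higher_pderiv_sum[of 1 f A] by simp

lemma
  fixes Q :: "real poly"
  assumes "degree Q \<le> n"
  shows poly_eq_sum_le: "poly Q x = (\<Sum>m\<le>n. coeff Q m * x ^ m)"
    and poly_pderiv_eq_sum_le: "poly (pderiv Q) x = (\<Sum>m\<le>n. coeff Q m * (real m * x ^ (m - 1)))"
proof -
  have Q: "Q = (\<Sum>m\<le>n. monom (coeff Q m) m)"
    using poly_as_sum_of_monoms'[OF assms] by simp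
  show "poly Q x = (\<Sum>m\<le>n. coeff Q m * x ^ m)"
    by (subst Q) (simp add: poly_sum poly_monom)
  show "poly (pderiv Q) x = (\<Sum>m\<le>n. coeff Q m * (real m * x ^ (m - 1)))"
    by (subst Q) (simp add: pderiv_sum poly_sum pderiv_monom poly_monom mult_ac)
qed

text \<open>The order conditions are this identity for the monomials of degree at most
  \<open>n\<close>, the sum condition on \<alpha> being degree 0. Both sides are linear in
  \<open>Q\<close>.\<close>

lemma lm_order_poly:
  fixes Q :: "real poly"
  assumes "lm_order k n \<alpha> \<beta>" and "degree Q \<le> n"
  shows "(\<Sum>j=1..k. \<alpha> j * poly Q (real j) - \<beta> j * poly (pderiv Q) (real j))
           - \<beta> 0 * poly (pderiv Q) 0 = poly Q 0"
proof -
  define S where "S m = (\<Sum>j=1..k. real j ^ m * \<alpha> j - real m * real j ^ (m - 1) * \<beta> j)" for m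
  have S: "S m - real m * 0 ^ (m - 1) * \<beta> 0 = 0 ^ m" if "m \<le> n" for m
    using assms(1) that unfolding lm_order_def S_def by (cases "m = 0") auto
  have "(\<Sum>j=1..k. \<alpha> j * poly Q (real j) - \<beta> j * poly (pderiv Q) (real j))
      = (\<Sum>j=1..k. \<Sum>m\<le>n. coeff Q m * (real j ^ m * \<alpha> j - real m * real j ^ (m - 1) * \<beta> j))"
    unfolding poly_eq_sum_le[OF assms(2)] poly_pderiv_eq_sum_le[OF assms(2)]
    by (simp add: sum_distrib_left sum_subtractf algebra_simps)
  also have "\<dots> = (\<Sum>m\<le>n. coeff Q m * S m)"
    unfolding S_def sum_distrib_left by (rule sum.swap)
  finally have "(\<Sum>j=1..k. \<alpha> j * poly Q (real j) - \<beta> j * poly (pderiv Q) (real j))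
        - \<beta> 0 * poly (pderiv Q) 0
      = (\<Sum>m\<le>n. coeff Q m * S m) - (\<Sum>m\<le>n. coeff Q m * (real m * 0 ^ (m - 1) * \<beta> 0))"
    unfolding poly_pderiv_eq_sum_le[OF assms(2)] by (simp only: sum_distrib_left mult_ac)
  also have "\<dots> = (\<Sum>m\<le>n. coeff Q m * (S m - real m * 0 ^ (m - 1) * \<beta> 0))"
    by (simp only: right_diff_distrib sum_subtractf)
  also have "\<dots> = (\<Sum>m\<le>n. coeff Q m * 0 ^ m)"
    by (intro sum.cong refl) (simp only: S atMost_iff)
  also have "\<dots> = poly Q 0"
    by (rule poly_eq_sum_le[OF assms(2), symmetric])
  finally show ?thesis .
qed

section \<open>The SSP coefficient as linear inequalities\<close>

lemma ssp_coeff_nonneg: "0 \<le> ssp_coeff k \<alpha> \<beta>"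
  by (auto simp: ssp_coeff_def)

text \<open>Positivity of \<open>r\<close> excludes the default value 0 given to methods that
  violate the sign conditions.\<close>

lemma le_ssp_coeff_iff:
  assumes "0 < r"
  shows "ereal r \<le> ssp_coeff k \<alpha> \<beta> \<longleftrightarrow>
    (\<forall>j\<in>{1..k}. r * \<beta> j \<le> \<alpha> j \<and> 0 \<le> \<alpha> j) \<and> (\<forall>j\<in>{0..k}. 0 \<le> \<beta> j)"
proof (cases "(\<forall>j\<in>{1..k}. 0 \<le> \<alpha> j) \<and> (\<forall>j\<in>{0..k}. 0 \<le> \<beta> j)")
  case False
  then show ?thesis
    using assms by (auto simp: ssp_coeff_def)
next
  case True
  have "r \<le> \<alpha> j / \<beta> j \<longleftrightarrow> r * \<beta> j \<le> \<alpha> j" if "j \<in> {1..k}" "\<beta> j \<noteq> 0" for j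
  proof -
    have "0 < \<beta> j"
      using True that by (metis atLeastAtMost_iff le0 order_le_less)
    then show ?thesis
      by (simp add: pos_le_divide_eq)
  qed
  moreover have "r * \<beta> j \<le> \<alpha> j" if "j \<in> {1..k}" "\<beta> j = 0" for j
    using True that by simp
  ultimately have "(\<forall>j\<in>{j \<in> {1..k}. \<beta> j \<noteq> 0}. r \<le> \<alpha> j / \<beta> j) \<longleftrightarrow> (\<forall>j\<in>{1..k}. r * \<beta> j \<le> \<alpha> j)"
    by blast
  moreover have "ereal r \<le> ssp_coeff k \<alpha> \<beta> \<longleftrightarrow> (\<forall>j\<in>{j \<in> {1..k}. \<beta> j \<noteq> 0}. r \<le> \<alpha> j / \<beta> j)"
    using True by (auto simp: ssp_coeff_def)
  ultimately show ?thesis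
    using True by blast
qed

section \<open>From implicit to explicit methods by duality\<close>

text \<open>Here \<open>x\<close> is the coefficient vector of a polynomial of degree at most
  \<open>p\<close>, and \<open>x 0\<close> is its value at 0. Negativity of \<open>x 0\<close> would
  make it the Farkas alternative to an explicit method.\<close>

lemma no_separating_vector:
  assumes order: "lm_order k (2 * p) \<alpha> \<beta>" and "0 < s"
    and ssp: "ereal (2 * s) \<le> ssp_coeff k \<alpha> \<beta>"
    and val: "\<And>j. j \<in> {1..k} \<Longrightarrow> 0 \<le> (\<Sum>m\<le>p. real j ^ m * x m)"
    and der: "\<And>j. j \<in> {1..k} \<Longrightarrow>
      0 \<le> (\<Sum>m\<le>p. (s * real j ^ m - real m * real j ^ (m - 1)) * x m)"
  shows "0 \<le> x 0"
proof (rule ccontr)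
  assume "\<not> 0 \<le> x 0"
  define q where "q = (\<Sum>m\<le>p. monom (x m) m) - [:x 0:]"
  define Q where "Q = q\<^sup>2"
  have poly_q: "poly q y = (\<Sum>m\<le>p. y ^ m * x m) - x 0" for y
    by (simp add: q_def poly_sum poly_monom mult_ac)
  have pderiv_q: "poly (pderiv q) y = (\<Sum>m\<le>p. real m * y ^ (m - 1) * x m)" for y
    by (simp add: q_def pderiv_diff pderiv_sum pderiv_pCons poly_sum pderiv_monom poly_monom mult_ac)
  have pderiv_Q: "poly (pderiv Q) y = 2 * poly q y * poly (pderiv q) y" for y
    by (simp add: Q_def power2_eq_square pderiv_mult)
  have "degree q \<le> p"
    unfolding q_def by (intro degree_diff_le degree_sum_le) (auto intro: order.trans[OF degree_monom_le])
  then have "degree Q \<le> 2 * p"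
    unfolding Q_def using degree_power_le[of q 2] by linarith
  have "poly q 0 = (\<Sum>m\<le>p. if m = 0 then x 0 else 0) - x 0"
    unfolding poly_q by (intro arg_cong2[where f = minus] sum.cong) (auto simp: power_0_left)
  then have "poly q 0 = 0"
    by simp
  \<comment> \<open>The double zero of \<open>Q\<close> at 0 removes the term with
    \<open>\<beta> 0\<close>, the only place where implicitness enters.\<close>
  then have eq: "(\<Sum>j=1..k. \<alpha> j * poly Q (real j) - \<beta> j * poly (pderiv Q) (real j)) = 0"
    using lm_order_poly[OF order \<open>degree Q \<le> 2 * p\<close>] by (simp add: pderiv_Q) (simp add: Q_def)
  have q_pos: "0 < poly q (real j)" if "j \<in> {1..k}" for j
    using val[OF that] \<open>\<not> 0 \<le> x 0\<close> by (simp add: poly_q)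
  have q_der: "0 < s * poly q (real j) - poly (pderiv q) (real j)" if "j \<in> {1..k}" for j
  proof -
    have "s * poly q (real j) - poly (pderiv q) (real j)
        = (\<Sum>m\<le>p. (s * real j ^ m - real m * real j ^ (m - 1)) * x m) - s * x 0"
      by (simp add: poly_q pderiv_q algebra_simps sum_distrib_left sum_subtractf)
    moreover have "s * x 0 < 0"
      using \<open>0 < s\<close> \<open>\<not> 0 \<le> x 0\<close> by (simp add: mult_pos_neg)
    ultimately show ?thesis
      using der[OF that] by linarith
  qed
  have coeffs: "2 * s * \<beta> j \<le> \<alpha> j" "0 \<le> \<beta> j" if "j \<in> {1..k}" for j
    using ssp that \<open>0 < s\<close> by (simp_all add: le_ssp_coeff_iff)
  have split: "\<alpha> j * poly Q (real j) - \<beta> j * poly (pderiv Q) (real j)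
      = (\<alpha> j - 2 * s * \<beta> j) * (poly q (real j))\<^sup>2
        + \<beta> j * (2 * poly q (real j) * (s * poly q (real j) - poly (pderiv q) (real j)))" for j
    unfolding pderiv_Q by (simp add: Q_def power2_eq_square algebra_simps)
  have nonneg: "0 \<le> (\<alpha> j - 2 * s * \<beta> j) * (poly q (real j))\<^sup>2"
    "0 \<le> \<beta> j * (2 * poly q (real j) * (s * poly q (real j) - poly (pderiv q) (real j)))"
    if "j \<in> {1..k}" for j
    using coeffs[OF that] q_pos[OF that] q_der[OF that] by simp_all
  \<comment> \<open>A zero sum of nonnegative terms: both parts of \<open>split\<close> vanish,
    which gives first \<open>\<alpha> j = 2 * s * \<beta> j\<close> and then
    \<open>\<beta> j = 0\<close>.\<close>
  have "\<alpha> j = 0" if j: "j \<in> {1..k}" for j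
  proof -
    have "\<alpha> j * poly Q (real j) - \<beta> j * poly (pderiv Q) (real j) = 0"
      using eq j by (subst (asm) sum_nonneg_eq_0_iff) (use nonneg in \<open>auto simp: split\<close>)
    then have "(\<alpha> j - 2 * s * \<beta> j) * (poly q (real j))\<^sup>2 = 0"
      "\<beta> j * (2 * poly q (real j) * (s * poly q (real j) - poly (pderiv q) (real j))) = 0"
      using nonneg[OF j] unfolding split by linarith+
    then show ?thesis
      using q_pos[OF j] q_der[OF j] by auto
  qed
  then have "(\<Sum>j=1..k. \<alpha> j) = 0"
    by simp
  then show False
    using order by (simp add: lm_order_def)
qed

lemma explicit_of_implicit:
  assumes order: "lm_order k (2 * p) \<alpha> \<beta>" and "0 < s"
    and ssp: "ereal (2 * s) \<le> ssp_coeff k \<alpha> \<beta>"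
  obtains \<alpha>' \<beta>' where "lm_explicit \<beta>'" and "lm_order k p \<alpha>' \<beta>'" and "ereal s \<le> ssp_coeff k \<alpha>' \<beta>'"
proof -
  \<comment> \<open>\<open>Inl j\<close> carries the weight
    \<open>\<alpha>' j - s * \<beta>' j\<close> and \<open>Inr j\<close> the weight
    \<open>\<beta>' j\<close>, so that the sign and SSP conditions become nonnegativity of all
    weights.\<close>
  define v :: "nat + nat \<Rightarrow> nat \<Rightarrow> real" where
    "v = case_sum (\<lambda>j m. real j ^ m) (\<lambda>j m. s * real j ^ m - real m * real j ^ (m - 1))"
  have nonneg: "0 \<le> (\<Sum>m\<le>p. 0 ^ m * x m)"
    if x: "\<And>i. i \<in> {1..k} <+> {1..k} \<Longrightarrow> 0 \<le> (\<Sum>m\<le>p. v i m * x m)" for x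
  proof -
    have "0 \<le> x 0"
    proof (rule no_separating_vector[OF order \<open>0 < s\<close> ssp, where x = x])
      fix j assume "j \<in> {1..k}"
      then show "0 \<le> (\<Sum>m\<le>p. real j ^ m * x m)"
        "0 \<le> (\<Sum>m\<le>p. (s * real j ^ m - real m * real j ^ (m - 1)) * x m)"
        using x[of "Inl j"] x[of "Inr j"] by (simp_all add: v_def InlI InrI)
    qed
    moreover have "(\<Sum>m\<le>p. 0 ^ m * x m) = (\<Sum>m\<le>p. if m = 0 then x 0 else 0)"
      by (intro sum.cong) (auto simp: power_0_left)
    ultimately show ?thesis
      by simp
  qed
  have "\<exists>c. (\<forall>i\<in>{1..k} <+> {1..k}. 0 \<le> c i) \<and>
    (\<forall>m\<in>{..p}. 0 ^ m = (\<Sum>i\<in>{1..k} <+> {1..k}. c i * v i m))"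
  proof (rule farkas)
    show "0 \<le> (\<Sum>m\<le>p. 0 ^ m * x m)"
      if "\<And>i. i \<in> {1..k} <+> {1..k} \<Longrightarrow> 0 \<le> (\<Sum>m\<le>p. v i m * x m)" for x
      using nonneg[of x] that by blast
  qed simp_all
  then obtain c where c: "(\<forall>i\<in>{1..k} <+> {1..k}. 0 \<le> c i) \<and>
    (\<forall>m\<in>{..p}. 0 ^ m = (\<Sum>i\<in>{1..k} <+> {1..k}. c i * v i m))" ..
  \<comment> \<open>Index 0 lies outside the Farkas system, so \<open>c (Inr 0)\<close> is arbitrary
    and must be replaced by 0.\<close>
  define \<beta>' where "\<beta>' j = (if j = 0 then 0 else c (Inr j))" for j
  define \<alpha>' where "\<alpha>' j = c (Inl j) + s * c (Inr j)" for j
  have moments: "(\<Sum>j=1..k. real j ^ m * \<alpha>' j - real m * real j ^ (m - 1) * \<beta>' j) = 0 ^ m"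
    if "m \<le> p" for m
  proof -
    have "(\<Sum>j=1..k. real j ^ m * \<alpha>' j - real m * real j ^ (m - 1) * \<beta>' j)
        = (\<Sum>j=1..k. c (Inl j) * v (Inl j) m + c (Inr j) * v (Inr j) m)"
      by (intro sum.cong) (auto simp: \<alpha>'_def \<beta>'_def v_def algebra_simps)
    also have "\<dots> = (\<Sum>i\<in>{1..k} <+> {1..k}. c i * v i m)"
      by (simp add: sum.Plus sum.distrib)
    finally show ?thesis
      using bspec[OF conjunct2[OF c], of m] that by simp
  qed
  have "\<beta>' 0 = 0"
    by (simp add: \<beta>'_def)
  show thesis
  proof (rule that)
    show "lm_explicit \<beta>'"
      using \<open>\<beta>' 0 = 0\<close> by (simp add: lm_explicit_def)
    show "lm_order k p \<alpha>' \<beta>'"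
      unfolding lm_order_def
    proof (intro conjI allI impI)
      show "(\<Sum>j=1..k. \<alpha>' j) = 1"
        using moments[of 0] by simp
    next
      fix m assume "1 \<le> m \<and> m \<le> p"
      then show "(\<Sum>j=1..k. real j ^ m * \<alpha>' j - real m * real j ^ (m - 1) * \<beta>' j)
          - real m * 0 ^ (m - 1) * \<beta>' 0 = 0"
        unfolding \<open>\<beta>' 0 = 0\<close> using moments[of m] by simp
    qed
    show "ereal s \<le> ssp_coeff k \<alpha>' \<beta>'"
    proof -
      have "0 \<le> c (Inl j)" "0 \<le> c (Inr j)" if "j \<in> {1..k}" for j
        using bspec[OF conjunct1[OF c]] that by blast+
      then show ?thesis
        using \<open>0 < s\<close> by (auto simp: le_ssp_coeff_iff \<alpha>'_def \<beta>'_def)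
    qed
  qed
qed

section \<open>Passage to the suprema\<close>

lemma ssp_coeff_le_C_exp:
  assumes "lm_explicit \<beta>" and "lm_order k p \<alpha> \<beta>"
  shows "ssp_coeff k \<alpha> \<beta> \<le> C_exp k p"
  using assms unfolding C_exp_def by (auto intro!: Sup_upper)

lemma C_exp_nonneg: "0 \<le> C_exp k p"
proof (cases "\<exists>\<alpha> \<beta>. lm_explicit \<beta> \<and> lm_order k p \<alpha> \<beta>")
  case True
  then obtain \<alpha> \<beta> where "lm_explicit \<beta>" "lm_order k p \<alpha> \<beta>"
    by blast
  then show ?thesis
    by (rule order.trans[OF ssp_coeff_nonneg ssp_coeff_le_C_exp])
next
  case False
  then show ?thesis
    unfolding C_exp_def by (simp only: if_False order_refl)
qed

theorem theorem4p2:
  fixes k p :: nat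
  assumes "1 \<le> k" and "1 \<le> p"
  shows "C_imp k (2 * p) \<le> 2 * C_exp k p"
proof -
  have "ssp_coeff k \<alpha> \<beta> \<le> 2 * C_exp k p" if order: "lm_order k (2 * p) \<alpha> \<beta>" for \<alpha> \<beta>
  \<comment> \<open>Testing against smaller \<open>y\<close> yields a real \<open>r\<close> in the
    positive case, so an infinite coefficient needs no separate treatment.\<close>
  proof (rule dense_le)
    fix y :: ereal
    assume y: "y < ssp_coeff k \<alpha> \<beta>"
    show "y \<le> 2 * C_exp k p"
    proof (cases "y \<le> 0")
      case True
      also have "0 \<le> 2 * C_exp k p"
        by (simp add: C_exp_nonneg)
      finally show ?thesis .
    next
      case False
      with y obtain r where r: "y = ereal r" "0 < r"
        by (cases y) auto
      then have "ereal (2 * (r / 2)) \<le> ssp_coeff k \<alpha> \<beta>"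
        using y by simp
      moreover have "0 < r / 2"
        using r(2) by simp
      ultimately obtain \<alpha>' \<beta>' where "lm_explicit \<beta>'" "lm_order k p \<alpha>' \<beta>'"
        "ereal (r / 2) \<le> ssp_coeff k \<alpha>' \<beta>'"
        using explicit_of_implicit[OF order] by metis
      then have "ereal (r / 2) \<le> C_exp k p"
        by (meson ssp_coeff_le_C_exp order.trans)
      then have "2 * ereal (r / 2) \<le> 2 * C_exp k p"
        by (rule ereal_mult_left_mono) simp
      moreover have "y = 2 * ereal (r / 2)"
        by (simp add: r)
      ultimately show ?thesis
        by simp
    qed
  qed
  \<comment> \<open>\<open>C_exp_nonneg\<close> covers the default value 0 of
    \<open>C_imp\<close>.\<close>
  then show ?thesis
    unfolding C_imp_def by (auto intro!: Sup_least simp: C_exp_nonneg)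
qed

end
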